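(* Let $(X,d)$ be a metric space with $|X|\geqslant 3$ and let $T\colon X\to X$ be a mapping contracting perimeters of triangles on $X$. Then $T$ is continuous.
   Context: Here $|X|$ denotes the cardinality of the set $X$. Definition: let $(X,d)$ be a metric space with $|X|\geqslant 3$. A mapping $T\colon X\to X$ is called a mapping contracting perimeters of triangles on $X$ if there exists $\alpha\in[0,1)$ such that the inequality $$d(Tx,Ty)+d(Ty,Tz)+d(Tx,Tz)\leqslant \alpha\,\bigl(d(x,y)+d(y,z)+d(x,z)\bigr)$$ holds for all triples of pairwise distinct points $x,y,z\in X$. *)

theory Defs
  imports "HOL-Analysis.Abstract_Metric_Spaces"
begin

definition contracting_perimeters_of_triangles ::
  "'a set \<Rightarrow> ('a \<Rightarrow> 'a \<Rightarrow> real) \<Rightarrow> ('a \<Rightarrow> 'a) \<Rightarrow> bool" where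
  "contracting_perimeters_of_triangles X d T \<longleftrightarrow>
     T \<in> X \<rightarrow> X \<and>
     (\<exists>\<alpha>::real. 0 \<le> \<alpha> \<and> \<alpha> < 1 \<and>
       (\<forall>x\<in>X. \<forall>y\<in>X. \<forall>z\<in>X. x \<noteq> y \<and> y \<noteq> z \<and> x \<noteq> z \<longrightarrow>
          d (T x) (T y) + d (T y) (T z) + d (T x) (T z)
            \<le> \<alpha> * (d x y + d y z + d x z)))"

end

theory Submission
  imports Defs
begin

text \<open>Continuity is checked at each point \<open>a\<close>. If \<open>a\<close> is isolated,
  {a} is itself an open neighbourhood. Otherwise the hypothesis, which bounds perimeters only, is
  turned into a bound on one distance: for \<open>x\<close> near \<open>a\<close> an auxiliary third
  point \<open>y\<close> is chosen still nearer to \<open>a\<close>. Then d(Ta,Tx) is at most the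
  perimeter of the image triangle, hence at most that of \<open>a\<close>, \<open>x\<close>,
  \<open>y\<close>, which the triangle inequality bounds by 2(d(a,x) + d(a,y)). This is small with
  \<open>x\<close> and \<open>y\<close> close to \<open>a\<close>.\<close>

theorem proposition2p3:
  fixes X :: "'a set" and d :: "'a \<Rightarrow> 'a \<Rightarrow> real" and T :: "'a \<Rightarrow> 'a"
  assumes "Metric_space X d"
    and "infinite X \<or> 3 \<le> card X"
    and "contracting_perimeters_of_triangles X d T"
  shows "continuous_map (Metric_space.mtopology X d) (Metric_space.mtopology X d) T"
proof -
  interpret Metric_space X d by fact
  have T: "T x \<in> X" if "x \<in> X" for x
    using assms(3) that by (auto simp: contracting_perimeters_of_triangles_def)
  obtain \<alpha> where \<alpha>: "0 \<le> \<alpha>" "\<alpha> < 1"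
    and contr: "\<forall>x\<in>X. \<forall>y\<in>X. \<forall>z\<in>X. x \<noteq> y \<and> y \<noteq> z \<and> x \<noteq> z \<longrightarrow>
      d (T x) (T y) + d (T y) (T z) + d (T x) (T z) \<le> \<alpha> * (d x y + d y z + d x z)"
    using assms(3) unfolding contracting_perimeters_of_triangles_def by (elim conjE exE)
  have "\<exists>U. openin mtopology U \<and> a \<in> U \<and> (\<forall>x\<in>U. T x \<in> mball (T a) \<epsilon>)"
    if a: "a \<in> X" and \<epsilon>: "\<epsilon> > 0" for a \<epsilon>
  proof (cases "\<exists>r>0. mball a r = {a}")
    case True
    then obtain r where "mball a r = {a}" by blast
    then have "openin mtopology {a}"
      using openin_mball[of a r] by simp
    moreover have "T a \<in> mball (T a) \<epsilon>"
      using \<epsilon> T[OF a] by simp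
    ultimately show ?thesis by blast
  next
    case False
    \<comment> \<open>The radius \<epsilon>/4 makes the final bound 2(d(a,x) + d(a,y)) less than
      \<epsilon>.\<close>
    have "T x \<in> mball (T a) \<epsilon>" if "x \<in> mball a (\<epsilon>/4)" for x
    proof (cases "x = a")
      case True
      then show ?thesis using \<epsilon> T[OF a] by simp
    next
      case neq: False
      have x: "x \<in> X" "d a x < \<epsilon>/4" "d a x > 0"
        using that a neq by auto
      \<comment> \<open>Since \<open>a\<close> is not isolated, this ball contains a point
        \<open>y\<close> other than \<open>a\<close>. Its radius is at most d(a,x), so
        \<open>y\<close> is strictly closer to \<open>a\<close> than \<open>x\<close> is.\<close>
      have "mball a (min (d a x) (\<epsilon>/4)) \<noteq> {a}"
        using False x(3) \<epsilon> by auto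
      moreover have "a \<in> mball a (min (d a x) (\<epsilon>/4))"
        using a x(3) \<epsilon> by simp
      ultimately obtain y where "y \<in> mball a (min (d a x) (\<epsilon>/4))" "y \<noteq> a"
        by blast
      then have y: "y \<in> X" "d a y < d a x" "d a y < \<epsilon>/4" "y \<noteq> a"
        by auto
      have "d (T a) (T x) \<le> d (T a) (T x) + d (T x) (T y) + d (T a) (T y)"
        using nonneg[of "T x" "T y"] nonneg[of "T a" "T y"] by linarith
      \<comment> \<open>The strict inequality d(a,y) < d(a,x) forces \<open>y\<close> to differ from
        \<open>x\<close>, so \<open>a\<close>, \<open>x\<close>, \<open>y\<close> are pairwise
        distinct and \<open>contr\<close> applies.\<close>
      also have "\<dots> \<le> \<alpha> * (d a x + d x y + d a y)"
        using contr a x(1) y(1,4) y(2) neq by (metis less_irrefl)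
      also have "\<dots> \<le> d a x + d x y + d a y"
        using \<alpha> by (intro mult_left_le_one_le) auto
      also have "\<dots> \<le> 2 * (d a x + d a y)"
        using triangle[OF x(1) a y(1)] commute[of x a] by simp
      also have "\<dots> < \<epsilon>"
        using x(2) y(3) by simp
      finally show ?thesis
        using T[OF a] T[OF x(1)] by simp
    qed
    then show ?thesis
      using a \<epsilon> by (intro exI[of _ "mball a (\<epsilon>/4)"]) auto
  qed
  then show ?thesis
    by (simp add: continuous_map_to_metric)
qed

end
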